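(* Let $\mathcal{X}$ be a hyperelliptic curve of genus $g\geq 1$ defined by the affine equation $y^2 + H(x)y = F(x)$ over the finite field $\mathbb{F}_q$, where $F$ is monic of degree $2g+1$ and $\deg(H)\le g$, with single point $P_\infty$ at infinity. Let $L \geq g$ be an integer with $L \equiv g \pmod 2$ and put $J = \tfrac{L + g}{2}$. Let $\gamma_1, \dots, \gamma_J \in \mathbb{F}_q$ be distinct elements such that $F(\gamma_j) \neq 0$ for all $j$, and set $h = \prod_{j=1}^{J} (x - \gamma_j)$. Let $X, T$ be nonnegative integers (the security and privacy parameters) and let $N = L + X + T + 6g + 2$. If there are $N + g$ distinct $\mathbb{F}_q$-rational points $P_1, \dots, P_{N + g}$ of $\mathcal{X}$, all different from $P_\infty$ and from the zeros of the function $y$, such that $h(P_n) \neq 0$ for all $n$, then there exists a PIR scheme over $\mathbb{F}_q$ (with $N$ servers and $L$ fragments per file) with rate $$\mathcal{R} = 1 - \frac{X + T + 6g + 2}{N}$$ which is $X$-secure and $T$-private.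
   Context: Curves. A curve over $\mathbb{F}_q$ means a smooth, projective, geometrically connected algebraic curve; the hyperelliptic curve is the (smooth projective) curve with the given affine equation, which has genus $g$ and exactly one point $P_\infty$ at infinity. The case $g=1$ (elliptic curves) is included. Codes. A (linear) code of length $N$ is an $\mathbb{F}_q$-subspace of $\mathbb{F}_q^N$; the $n$th coordinate of $c$ is written $c(n)$. Linear secret sharing schemes. A linear secret sharing scheme (LSSS) over $\mathbb{F}_q$ with $N$ parties is a pair $(\mathcal{C},\mathcal{C}^{\mathrm{noise}})$ of linear codes in $\mathbb{F}_q^N$ with $\mathcal{C}\cap\mathcal{C}^{\mathrm{noise}}=0$. The secret is encoded as $c\in\mathcal{C}$, the share vector $\hat{c}$ is chosen uniformly at random from $c+\mathcal{C}^{\mathrm{noise}}$, and party $n\in[N]=\{1,\dots,N\}$ receives $\hat{c}(n)$. The LSSS is $T$-secure if for every set $\mathcal{T}\subseteq[N]$ of $T$ parties the distribution of $(\hat{c}(n))_{n\in\mathcal{T}}$ does not depend on the secret $c$. PIR schemes. A PIR scheme over $\mathbb{F}_q$ with $N$ servers and $L$ fragments per file is a collection of LSSSs $(\mathcal{C}_\ell,\mathcal{C}_\ell^{\mathrm{noise}})$ and $(\mathcal{D}_\ell,\mathcal{D}_\ell^{\mathrm{noise}})$, $\ell\in[L]$, over $\mathbb{F}_q$ with $N$ parties, with one-dimensional codes $\mathcal{C}_\ell=\mathrm{span}\{c_\ell\}$ and $\mathcal{D}_\ell=\mathrm{span}\{d_\ell\}$, used in the following protocol and required to be decodable in the sense below.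 There are $M$ files $s_1,\dots,s_M\in\mathbb{F}_q^L$, $s_m=(s_{m,1},\dots,s_{m,L})$, and the user wants file $s_\mu$, $\mu\in[M]$. Put $q_{m,\ell}=\delta_{m,\mu}$ (Kronecker delta). Choose, independently and uniformly at random, $\hat{s}_{m,\ell}\in s_{m,\ell}c_\ell+\mathcal{C}_\ell^{\mathrm{noise}}$ and $\hat{q}_{m,\ell}\in q_{m,\ell}d_\ell+\mathcal{D}_\ell^{\mathrm{noise}}$ for all $m\in[M]$, $\ell\in[L]$. Server $n$ stores $\hat{s}_{m,\ell}(n)$, receives the query $\hat{q}_{m,\ell}(n)$ (for all $m,\ell$), and responds with $r(n)=\sum_{\ell\in[L]}\sum_{m\in[M]}\hat{s}_{m,\ell}(n)\hat{q}_{m,\ell}(n)$. Decodability: there is a decoding function $\mathbb{F}_q^N\to\mathbb{F}_q^L$ that, for every $M$, every $\mu$, all files and all realizations of the randomness, maps $r=(r(1),\dots,r(N))$ to $s_\mu$. The PIR scheme is $X$-secure if every LSSS $(\mathcal{C}_\ell,\mathcal{C}_\ell^{\mathrm{noise}})$ is $X$-secure, and $T$-private if every LSSS $(\mathcal{D}_\ell,\mathcal{D}_\ell^{\mathrm{noise}})$ is $T$-secure. Its rate is the ratio of the file size to the number of downloaded symbols, $\mathcal{R}=L/N$. *)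

theory Defs
  imports
    "HOL-Algebra.Algebraic_Closure_Type"
    "HOL-Probability.Probability_Mass_Function"
    "HOL-Analysis.Cartesian_Space"
    "HOL-Computational_Algebra.Polynomial"
begin

section \<open>Hyperelliptic curves\<close>

text \<open>
  The curve with affine equation \<open>y\<^sup>2 + H(x) y = F(x)\<close> is given by the pair of polynomials
  \<open>H\<close>, \<open>F\<close>. Geometric nonsingularity of the affine model is the Jacobian criterion over the
  algebraic closure. For \<open>F\<close> monic of degree \<open>2 * g + 1\<close> and \<open>degree H \<le> g\<close> the equation is
  automatically absolutely irreducible, and its smooth projective model has genus \<open>g\<close> exactly
  when the affine model is nonsingular; that model consists of the affine points and a single
  rational point at infinity.
\<close>

definition affine_nonsingular :: "'a::field poly \<Rightarrow> 'a poly \<Rightarrow> bool" where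
  "affine_nonsingular H F \<longleftrightarrow>
     (\<forall>a b :: 'a alg_closure.
        b ^ 2 + poly (map_poly to_ac H) a * b = poly (map_poly to_ac F) a \<longrightarrow>
        \<not> (2 * b + poly (map_poly to_ac H) a = 0 \<and>
           poly (pderiv (map_poly to_ac H)) a * b = poly (pderiv (map_poly to_ac F)) a))"

definition hyperelliptic_curve :: "nat \<Rightarrow> 'a::field poly \<Rightarrow> 'a poly \<Rightarrow> bool" where
  "hyperelliptic_curve g H F \<longleftrightarrow>
     lead_coeff F = 1 \<and> degree F = 2 * g + 1 \<and> degree H \<le> g \<and> affine_nonsingular H F"

datatype 'a curve_point = Infinity | Affine (x_coord: 'a) (y_coord: 'a)

definition rational_points :: "'a::field poly \<Rightarrow> 'a poly \<Rightarrow> 'a curve_point set" where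
  "rational_points H F =
     insert Infinity {Affine a b | a b. b ^ 2 + poly H a * b = poly F a}"


section \<open>Linear secret sharing schemes\<close>

text \<open>The parties are the elements of the finite index type \<open>'n\<close>.\<close>

type_synonym ('a, 'n) lsss = "('a ^ 'n) set \<times> ('a ^ 'n) set"

definition is_lsss :: "('a::field, 'n::finite) lsss \<Rightarrow> bool" where
  "is_lsss = (\<lambda>(C, Cnoise). vec.subspace C \<and> vec.subspace Cnoise \<and> C \<inter> Cnoise = {0})"

definition share_vectors :: "('a::field ^ 'n) set \<Rightarrow> 'a ^ 'n \<Rightarrow> ('a ^ 'n) set" where
  "share_vectors Cnoise c = (\<lambda>z. c + z) ` Cnoise"

text \<open>The joint distribution of the shares received by the parties in \<open>S\<close>.\<close>

definition share_distribution ::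
    "('a::{field,finite} ^ 'n) set \<Rightarrow> 'n set \<Rightarrow> 'a ^ 'n \<Rightarrow> ('n \<Rightarrow> 'a) pmf" where
  "share_distribution Cnoise S c =
     map_pmf (\<lambda>v. restrict (\<lambda>n. v $ n) S) (pmf_of_set (share_vectors Cnoise c))"

definition lsss_secure :: "nat \<Rightarrow> ('a::{field,finite}, 'n::finite) lsss \<Rightarrow> bool" where
  "lsss_secure T = (\<lambda>(C, Cnoise).
     \<forall>S. card S = T \<longrightarrow>
       (\<forall>c\<in>C. \<forall>c'\<in>C. share_distribution Cnoise S c = share_distribution Cnoise S c'))"


section \<open>PIR schemes\<close>

text \<open>
  The servers are the elements of \<open>'n\<close>. Files and fragments are numbered from 1, and only the
  values of the families at the indices \<open>1, \<dots>, num_fragments S\<close> matter.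
\<close>

record ('a, 'n::finite) pir =
  num_fragments :: nat
  storage_vec :: "nat \<Rightarrow> 'a ^ 'n"
  storage_noise :: "nat \<Rightarrow> ('a ^ 'n) set"
  query_vec :: "nat \<Rightarrow> 'a ^ 'n"
  query_noise :: "nat \<Rightarrow> ('a ^ 'n) set"

definition storage_lsss :: "('a::field, 'n::finite) pir \<Rightarrow> nat \<Rightarrow> ('a, 'n) lsss" where
  "storage_lsss S l = (vec.span {storage_vec S l}, storage_noise S l)"

definition query_lsss :: "('a::field, 'n::finite) pir \<Rightarrow> nat \<Rightarrow> ('a, 'n) lsss" where
  "query_lsss S l = (vec.span {query_vec S l}, query_noise S l)"

text \<open>
  Possible outcomes of storing the \<open>M\<close> files \<open>s m = (s m 1, \<dots>, s m L)\<close>, and of querying for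
  the file with index \<open>mu\<close>.
\<close>

definition storage_outcome ::
    "('a::field, 'n::finite) pir \<Rightarrow> nat \<Rightarrow> (nat \<Rightarrow> nat \<Rightarrow> 'a) \<Rightarrow> (nat \<Rightarrow> nat \<Rightarrow> 'a ^ 'n) \<Rightarrow> bool" where
  "storage_outcome S M s s_hat \<longleftrightarrow>
     (\<forall>m\<in>{1..M}. \<forall>l\<in>{1..num_fragments S}.
        s_hat m l \<in> share_vectors (storage_noise S l) (s m l *s storage_vec S l))"

definition query_outcome ::
    "('a::field, 'n::finite) pir \<Rightarrow> nat \<Rightarrow> nat \<Rightarrow> (nat \<Rightarrow> nat \<Rightarrow> 'a ^ 'n) \<Rightarrow> bool" where
  "query_outcome S M mu q_hat \<longleftrightarrow>
     (\<forall>m\<in>{1..M}. \<forall>l\<in>{1..num_fragments S}.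
        q_hat m l \<in> share_vectors (query_noise S l)
                      ((if m = mu then 1 else 0) *s query_vec S l))"

definition response ::
    "('a::field, 'n::finite) pir \<Rightarrow> nat \<Rightarrow> (nat \<Rightarrow> nat \<Rightarrow> 'a ^ 'n) \<Rightarrow> (nat \<Rightarrow> nat \<Rightarrow> 'a ^ 'n)
      \<Rightarrow> 'a ^ 'n" where
  "response S M s_hat q_hat =
     (\<chi> n. \<Sum>l = 1..num_fragments S. \<Sum>m = 1..M. s_hat m l $ n * q_hat m l $ n)"

definition pir_decodable :: "('a::field, 'n::finite) pir \<Rightarrow> bool" where
  "pir_decodable S \<longleftrightarrow>
     (\<exists>dec :: 'a ^ 'n \<Rightarrow> nat \<Rightarrow> 'a.
        \<forall>M. \<forall>mu\<in>{1..M}. \<forall>s s_hat q_hat.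
          storage_outcome S M s s_hat \<longrightarrow> query_outcome S M mu q_hat \<longrightarrow>
          (\<forall>l\<in>{1..num_fragments S}. dec (response S M s_hat q_hat) l = s mu l))"

definition is_pir_scheme :: "('a::field, 'n::finite) pir \<Rightarrow> bool" where
  "is_pir_scheme S \<longleftrightarrow>
     (\<forall>l\<in>{1..num_fragments S}.
        is_lsss (storage_lsss S l) \<and> vec.dim (fst (storage_lsss S l)) = 1 \<and>
        is_lsss (query_lsss S l) \<and> vec.dim (fst (query_lsss S l)) = 1) \<and>
     pir_decodable S"

definition pir_secure :: "nat \<Rightarrow> ('a::{field,finite}, 'n::finite) pir \<Rightarrow> bool" where
  "pir_secure K S \<longleftrightarrow> (\<forall>l\<in>{1..num_fragments S}. lsss_secure K (storage_lsss S l))"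

definition pir_private :: "nat \<Rightarrow> ('a::{field,finite}, 'n::finite) pir \<Rightarrow> bool" where
  "pir_private T S \<longleftrightarrow> (\<forall>l\<in>{1..num_fragments S}. lsss_secure T (query_lsss S l))"

definition pir_rate :: "('a, 'n::finite) pir \<Rightarrow> real" where
  "pir_rate S = real (num_fragments S) / real CARD('n)"

end

theory Submission
  imports Defs
begin

text \<open>
  Cross-subspace alignment on the curve. Fragment \<open>l\<close> is stored as a multiple of \<open>1 / (x - \<gamma>)\<close>
  masked by functions with poles only at infinity, and it is queried by a multiple of \<open>1\<close> or of
  \<open>y\<close> masked by multiples of \<open>x - \<gamma>\<close>. In a product of a share and a query every term except
  the wanted multiple of \<open>1 / (x - \<gamma>)\<close> or \<open>y / (x - \<gamma>)\<close> has its poles at infinity only, so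
  all interference of all fragments lies in one Riemann--Roch space. A function with fewer poles
  than there are servers is determined by its values at the servers, and partial fractions separate
  the wanted terms from the interference. Security and privacy say that a space of functions with
  poles at infinity takes arbitrary values at few points.

  Only the affine coordinate ring \<open>K[x] + K[x] y\<close> is used, with pole order \<open>2 deg a\<close> resp.
  \<open>2 deg b + 2 g + 1\<close> of \<open>a(x)\<close> resp. \<open>b(x) y\<close>: zeros are counted with the norm to \<open>K[x]\<close>,
  and the surjectivity part of Riemann--Roch reduces to that count by Lagrange duality.
\<close>

no_notation fps_nth (infixl "$" 75)

section \<open>Zeros of functions on the affine curve\<close>

text \<open>Points with a common value \<open>f z = a\<close> are charged to the multiplicity of the
  root \<open>a\<close>, so the multiset of values of \<open>f\<close> is contained in the multiset
  of roots of \<open>n\<close>.\<close>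

lemma sum_count_order_le_degree:
  fixes n :: "'a::field poly"
  assumes "finite Z" "n \<noteq> 0"
    and "\<And>a. card {z \<in> Z. f z = a} \<le> Polynomial.order a n"
  shows "card Z \<le> degree n"
proof -
  have "image_mset f (mset_set Z) \<subseteq># proots n"
  proof (rule mset_subset_eqI)
    fix a
    have "count (image_mset f (mset_set Z)) a = card {z \<in> Z. f z = a}"
      unfolding count_image_mset card_eq_sum using assms(1) by (intro sum.cong) auto
    then show "count (image_mset f (mset_set Z)) a \<le> count (proots n) a"
      using assms(2,3) by (simp add: count_proots)
  qed
  then have "size (image_mset f (mset_set Z)) \<le> size (proots n)"
    by (rule size_mset_mono)
  also have "\<dots> \<le> degree n"
    by (rule size_proots_le)
  finally show ?thesis by simp
qed

text \<open>The norm of \<open>a + b y\<close> to polynomials in \<open>x\<close>: its product with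
  the conjugate, in which \<open>y\<close> is replaced by \<open>- H - y\<close>.\<close>

definition norm_poly :: "'a::field poly \<Rightarrow> 'a poly \<Rightarrow> 'a poly \<Rightarrow> 'a poly \<Rightarrow> 'a poly" where
  "norm_poly H F a b = a * a - a * b * H - b * b * F"

text \<open>
  The terms \<open>a\<^sup>2\<close> and \<open>b\<^sup>2 F\<close> have degrees of different parity, and the degree of \<open>a b H\<close> is
  smaller than the larger of the two, so no cancellation is possible.
\<close>

lemma norm_poly_eq_0D:
  assumes "degree F = 2 * g + 1" "degree H \<le> g" "norm_poly H F a b = 0"
  shows "a = 0 \<and> b = 0"
proof (rule ccontr)
  assume neg: "\<not> (a = 0 \<and> b = 0)"
  have "F \<noteq> 0" using assms(1) by auto
  have eq: "a * a = a * b * H + b * b * F"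
    using assms(3) by (simp add: norm_poly_def algebra_simps)
  have "a \<noteq> 0" "b \<noteq> 0" using eq neg \<open>F \<noteq> 0\<close> by auto
  have d1: "degree (a * a) = 2 * degree a" using \<open>a \<noteq> 0\<close> by (simp add: degree_mult_eq)
  have d2: "degree (b * b * F) = 2 * degree b + 2 * g + 1"
    using \<open>b \<noteq> 0\<close> \<open>F \<noteq> 0\<close> assms(1) by (simp add: degree_mult_eq)
  have d3: "degree (a * b * H) \<le> degree a + degree b + g"
    using degree_mult_le[of "a * b" H] degree_mult_le[of a b] assms(2) by linarith
  show False
  proof (cases "degree a \<le> degree b + g")
    case True
    have "degree (a * a - a * b * H) \<le> 2 * degree b + 2 * g"
      using d1 d3 True by (intro degree_diff_le) auto
    moreover have "b * b * F = a * a - a * b * H" using eq by simp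
    ultimately show False using d2 by simp
  next
    case False
    have "degree (a * b * H + b * b * F) \<le> 2 * degree a - 1"
      using d2 d3 False by (intro degree_add_le) auto
    then show False using d1 eq False by simp
  qed
qed

text \<open>The norm of a nonzero function has a root under every zero, a double one where two zeros
  share their \<open>x\<close>, while the bounds on the pole order keep its degree below
  \<open>card Z\<close>.\<close>

lemma zero_count:
  fixes Z :: "('a::field \<times> 'a) set"
  assumes F: "degree F = 2 * g + 1" and H: "degree H \<le> g" and fin: "finite Z"
    and curve: "\<And>x y. (x, y) \<in> Z \<Longrightarrow> y ^ 2 + poly H x * y = poly F x"
    and zero: "\<And>x y. (x, y) \<in> Z \<Longrightarrow> poly a x + poly b x * y = 0"
    and dega: "a = 0 \<or> 2 * degree a < card Z"
    and degb: "b = 0 \<or> 2 * degree b + 2 * g + 1 < card Z"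
  shows "a = 0 \<and> b = 0"
proof (rule ccontr)
  assume neg: "\<not> (a = 0 \<and> b = 0)"
  let ?n = "norm_poly H F a b"
  have n0: "?n \<noteq> 0" using norm_poly_eq_0D[OF F H] neg by blast
  have "card {z \<in> Z. fst z = x} \<le> Polynomial.order x ?n" for x
  proof -
    let ?S = "{z \<in> Z. fst z = x}"
    have two: "[:-x, 1:] ^ 2 dvd ?n"
      if "(x, y) \<in> Z" "(x, y') \<in> Z" "y \<noteq> y'" for y y'
    proof -
      \<comment> \<open>Two zeros over the same \<open>x\<close> make both \<open>a\<close> and
        \<open>b\<close> vanish there, so a linear factor comes out of both and appears squared in
        the norm.\<close>
      have "poly b x * (y - y') = 0"
        using zero[OF that(1)] zero[OF that(2)]
        by (metis add_left_cancel right_diff_distrib right_minus_eq)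
      then have "poly b x = 0" "poly a x = 0" using that zero[OF that(1)] by auto
      then obtain a' b' where "a = [:-x, 1:] * a'" "b = [:-x, 1:] * b'"
        by (auto simp: poly_eq_0_iff_dvd dvd_def)
      then have "?n = [:-x, 1:] ^ 2 * norm_poly H F a' b'"
        by (simp only: norm_poly_def power2_eq_square) (simp only: algebra_simps)
      then show ?thesis by simp
    qed
    have one: "poly ?n x = 0" if "(x, y) \<in> Z" for y
    proof -
      have "poly a x = - poly b x * y" using zero[OF that] by (simp add: eq_neg_iff_add_eq_0)
      moreover have "poly F x = y * y + poly H x * y"
        using curve[OF that] by (simp add: power2_eq_square)
      ultimately show ?thesis by (simp add: norm_poly_def algebra_simps)
    qed
    have S: "?S \<subseteq> {(x, y), (x, - poly H x - y)}" if "(x, y) \<in> Z" for y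
    proof
      fix z assume "z \<in> ?S"
      then obtain y' where z: "z = (x, y')" "(x, y') \<in> Z" by (cases z) auto
      have "y ^ 2 + poly H x * y = y' ^ 2 + poly H x * y'" using curve that z by metis
      then have "(y - y') * (y + y' + poly H x) = 0"
        by (simp add: power2_eq_square algebra_simps)
      then have "y' = y \<or> y + y' + poly H x = 0" by auto
      moreover have "y' = - poly H x - y" if "y + y' + poly H x = 0"
        using that by (simp add: eq_diff_eq eq_neg_iff_add_eq_0 ac_simps)
      ultimately have "y' = y \<or> y' = - poly H x - y" by blast
      then show "z \<in> {(x, y), (x, - poly H x - y)}" using z by auto
    qed
    show ?thesis
    proof (cases "?S = {}")
      case False
      then obtain y where y: "(x, y) \<in> Z" by auto
      show ?thesis
      proof (cases "\<exists>y'. (x, y') \<in> Z \<and> y \<noteq> y'")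
        case False
        then have "\<And>z. z \<in> Z \<Longrightarrow> fst z = x \<Longrightarrow> z = (x, y)" by (metis prod.collapse)
        moreover have "(x, y) \<in> ?S" using y by simp
        ultimately have "?S = {(x, y)}" by blast
        then have "card ?S = 1" by simp
        moreover have "Polynomial.order x ?n \<noteq> 0"
          using one[OF y] n0 order_root[of ?n x] by blast
        ultimately show ?thesis by linarith
      next
        case True
        then obtain y' where "(x, y') \<in> Z" "y \<noteq> y'" by blast
        then have "2 \<le> Polynomial.order x ?n"
          using two[OF y] n0 by (simp add: order_divides)
        moreover have "card ?S \<le> 2"
          by (rule order_trans[OF card_mono[OF _ S[OF y]]]) (auto simp: card_insert_if)
        ultimately show ?thesis by linarith
      qed
    next
      case True
      then have "card ?S = 0" by (simp only: card.empty)
      then show ?thesis by linarith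
    qed
  qed
  then have "card Z \<le> degree ?n"
    by (rule sum_count_order_le_degree[OF fin n0])
  moreover have "degree ?n < card Z"
  proof -
    have 1: "a = 0 \<or> degree (a * a) < card Z"
      using dega degree_mult_le[of a a] by linarith
    have 2: "b = 0 \<or> degree (b * b * F) < card Z"
      using degb degree_mult_le[of "b * b" F] degree_mult_le[of b b] F by linarith
    \<comment> \<open>The degree of the cross term is below the mean of the two pole orders.\<close>
    have 3: "a = 0 \<or> b = 0 \<or> degree (a * b * H) < card Z"
      using dega degb degree_mult_le[of "a * b" H] degree_mult_le[of a b] H by linarith
    show ?thesis using 1 2 3 neg unfolding norm_poly_def
      by (auto intro!: degree_diff_less)
  qed
  ultimately show False by simp
qed

section \<open>Surjectivity of evaluation\<close>

text \<open>A trivial annihilator makes the transpose of a matrix with image in \<open>W\<close>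
  injective. Transposing a left inverse gives a right inverse, so the matrix is onto.\<close>

lemma subspace_eq_UNIV_if_annihilator_trivial:
  fixes W :: "('a::{field,finite} ^ 'n::finite) set"
  assumes W: "vec.subspace W"
    and dual: "\<And>f. \<lbrakk>\<And>w. w \<in> W \<Longrightarrow> (\<Sum>i\<in>UNIV. f $ i * w $ i) = 0\<rbrakk> \<Longrightarrow> f = 0"
  shows "W = UNIV"
proof -
  \<comment> \<open>the columns of \<open>A\<close> are the elements of \<open>W\<close>; indexing by the whole space avoids a new index type\<close>
  define A :: "'a ^ ('a ^ 'n) ^ 'n" where "A = (\<chi> i w. if w \<in> W then w $ i else 0)"
  have "inj ((*v) (transpose A))"
  proof (subst vec.inj_iff_eq_0, intro allI impI)
    fix f :: "'a ^ 'n" assume f: "transpose A *v f = 0"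
    show "f = 0"
    proof (rule dual)
      fix w assume "w \<in> W"
      then have "(transpose A *v f) $ w = (\<Sum>i\<in>UNIV. f $ i * w $ i)"
        by (simp add: matrix_vector_mult_def transpose_def A_def mult.commute)
      then show "(\<Sum>i\<in>UNIV. f $ i * w $ i) = 0" using f by simp
    qed
  qed
  then obtain B where "B ** transpose A = mat 1"
    using matrix_left_invertible_injective by blast
  then have "A ** transpose B = mat 1"
    by (metis matrix_transpose_mul transpose_mat transpose_transpose)
  then have surj: "surj ((*v) A)" using matrix_right_invertible_surjective by blast
  have "A *v f \<in> W" for f
  proof -
    have "A *v f = (\<Sum>w\<in>UNIV. f $ w *s (if w \<in> W then w else 0))"
      by (simp add: vec_eq_iff matrix_vector_mult_def A_def sum_component)
         (auto intro!: sum.cong)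
    also have "\<dots> \<in> W"
      using vec.subspace_0[OF W] by (intro vec.subspace_sum[OF W] vec.subspace_scale[OF W]) auto
    finally show ?thesis .
  qed
  then show ?thesis using surj by (metis UNIV_eq_I surjD)
qed

text \<open>Left monic instead of normalised to the value 1 at \<open>x\<close>. For
  \<open>x\<close> in \<open>U\<close> the value there is the derivative of the product over all of
  \<open>U\<close>, the usual denominator in residue formulas.\<close>

definition lagrange_basis :: "'a::field set \<Rightarrow> 'a \<Rightarrow> 'a poly" where
  "lagrange_basis U x = (\<Prod>z\<in>U - {x}. [:- z, 1:])"

lemma poly_lagrange_basis_neq:
  assumes "finite U" "y \<in> U" "x \<noteq> y"
  shows "poly (lagrange_basis U x) y = 0"
  using assms by (auto simp: lagrange_basis_def poly_prod intro!: prod_zero bexI[of _ y])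

lemma poly_lagrange_basis_self_nonzero:
  assumes "finite U"
  shows "poly (lagrange_basis U x) x \<noteq> 0"
  using assms by (auto simp: lagrange_basis_def poly_prod)

lemma degree_lagrange_basis:
  assumes "finite U" "x \<in> U"
  shows "degree (lagrange_basis U x) = card U - 1"
proof -
  have "degree (lagrange_basis U x) = (\<Sum>z\<in>U - {x}. degree [:- z, 1:])"
    unfolding lagrange_basis_def by (rule degree_prod_sum_eq) simp
  then show ?thesis using assms by simp
qed

lemma lead_coeff_lagrange_basis: "lead_coeff (lagrange_basis U x) = 1"
  unfolding lagrange_basis_def lead_coeff_prod by simp

lemma poly_lagrange_sum:
  assumes "finite U" "y \<in> U"
  shows "poly (\<Sum>x\<in>U. smult (f x) (lagrange_basis U x)) y = f y * poly (lagrange_basis U y) y"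
proof -
  have "poly (\<Sum>x\<in>U. smult (f x) (lagrange_basis U x)) y
      = (\<Sum>x\<in>U. f x * poly (lagrange_basis U x) y)"
    by (simp add: poly_sum)
  also have "\<dots> = (\<Sum>x\<in>U. if x = y then f y * poly (lagrange_basis U y) y else 0)"
    using assms by (intro sum.cong) (auto simp: poly_lagrange_basis_neq)
  finally show ?thesis using assms by simp
qed

lemma degree_lagrange_sum_less:
  assumes "finite U" "U \<noteq> {}"
  shows "degree (\<Sum>x\<in>U. smult (f x) (lagrange_basis U x)) < card U"
proof -
  have "degree (\<Sum>x\<in>U. smult (f x) (lagrange_basis U x)) \<le> card U - 1"
    using assms(1) by (intro degree_sum_le) (auto intro: degree_smult_le[THEN order_trans]
        simp: degree_lagrange_basis)
  then show ?thesis using assms card_gt_0_iff[of U] by linarith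
qed

text \<open>A form of the residue theorem: \<open>q\<close> equals its interpolant, and each basis
  polynomial is monic of degree \<open>card U - 1\<close>.\<close>

lemma top_coeff_interpolation:
  fixes q :: "'a::field poly"
  assumes "finite U" "degree q < card U"
  shows "Polynomial.coeff q (card U - 1) = (\<Sum>x\<in>U. poly q x / poly (lagrange_basis U x) x)"
proof -
  let ?f = "\<lambda>x. poly q x / poly (lagrange_basis U x) x"
  let ?p = "\<Sum>x\<in>U. smult (?f x) (lagrange_basis U x)"
  have "U \<noteq> {}" using assms(2) by auto
  have "q = ?p"
    using assms \<open>U \<noteq> {}\<close>
    by (intro poly_eqI_degree[of U] degree_lagrange_sum_less)
       (auto simp: poly_lagrange_sum poly_lagrange_basis_self_nonzero)
  then have "Polynomial.coeff q (card U - 1) = Polynomial.coeff ?p (card U - 1)" by simp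
  also have "\<dots> = (\<Sum>x\<in>U. ?f x * Polynomial.coeff (lagrange_basis U x) (card U - 1))"
    by (simp add: coeff_sum)
  also have "\<dots> = sum ?f U"
  proof (rule sum.cong)
    fix x assume "x \<in> U"
    then have "Polynomial.coeff (lagrange_basis U x) (card U - 1) = 1"
      using lead_coeff_lagrange_basis[of U x] degree_lagrange_basis[OF assms(1), of x] by simp
    then show "?f x * Polynomial.coeff (lagrange_basis U x) (card U - 1) = ?f x" by simp
  qed simp
  finally show ?thesis .
qed

text \<open>
  The polynomial \<open>c\<close> is the numerator of \<open>\<Sum>u. f u / (x - u)\<close>; the power sums in the hypothesis are
  the leading coefficients of the expansion of this fraction at infinity.
\<close>

lemma functional_killing_low_degree:
  fixes f :: "'a::field \<Rightarrow> 'a"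
  assumes U: "finite U" and f: "\<And>n. n < A \<Longrightarrow> (\<Sum>x\<in>U. f x * x ^ n) = 0"
  shows "\<exists>c. (\<forall>x\<in>U. poly c x = f x * poly (lagrange_basis U x) x) \<and>
    (c = 0 \<or> degree c + A < card U)"
proof -
  define c where "c = (\<Sum>x\<in>U. smult (f x) (lagrange_basis U x))"
  have c: "poly c x = f x * poly (lagrange_basis U x) x" if "x \<in> U" for x
    unfolding c_def by (rule poly_lagrange_sum[OF U that])
  have "degree c + A < card U" if "c \<noteq> 0"
  proof (rule ccontr)
    assume neg: "\<not> degree c + A < card U"
    have "U \<noteq> {}" using that by (auto simp: c_def)
    then have deg: "degree c < card U" unfolding c_def by (rule degree_lagrange_sum_less[OF U])
    \<comment> \<open>Multiplying \<open>c\<close> by the \<open>n\<close>-th power of the variable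
      raises its degree to exactly \<open>card U - 1\<close>. The top coefficient of the product is
      then one of the vanishing power sums.\<close>
    define n where "n = card U - 1 - degree c"
    have n: "n < A" "degree c + n = card U - 1" using neg deg by (auto simp: n_def)
    define q where "q = monom 1 n * c"
    have degq: "degree q = card U - 1"
      using that n by (simp add: q_def degree_mult_eq degree_monom_eq add.commute)
    have "lead_coeff q \<noteq> 0" using that by (simp add: q_def)
    moreover have "Polynomial.coeff q (card U - 1) = 0"
    proof -
      have "Polynomial.coeff q (card U - 1) = (\<Sum>x\<in>U. poly q x / poly (lagrange_basis U x) x)"
        using degq deg by (intro top_coeff_interpolation[OF U]) linarith
      also have "\<dots> = (\<Sum>x\<in>U. f x * x ^ n)"
        using U c by (intro sum.cong)
          (auto simp: q_def poly_monom poly_lagrange_basis_self_nonzero)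
      finally show ?thesis using f[OF n(1)] by simp
    qed
    ultimately show False using degq by simp
  qed
  then show ?thesis using c by blast
qed

section \<open>Evaluation codes of functions with poles only at infinity\<close>

text \<open>
  The values of the functions \<open>a(x) + b(x) y\<close> whose pole order at infinity is strictly less than
  \<open>k\<close>, i.e. of the elements of \<open>L((k - 1) P\<^sub>\<infinity>)\<close>.
\<close>

definition eval_code :: "nat \<Rightarrow> ('n \<Rightarrow> 'a::field) \<Rightarrow> ('n \<Rightarrow> 'a) \<Rightarrow> nat \<Rightarrow> ('a ^ 'n::finite) set" where
  "eval_code g x y k = {\<chi> i. poly a (x i) + poly b (x i) * y i | a b.
     (a = 0 \<or> 2 * degree a < k) \<and> (b = 0 \<or> 2 * degree b + 2 * g + 1 < k)}"

lemma eval_codeI: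
  assumes "\<And>i. v $ i = poly a (x i) + poly b (x i) * y i"
    and "a = 0 \<or> 2 * degree a < k" "b = 0 \<or> 2 * degree b + 2 * g + 1 < k"
  shows "v \<in> eval_code g x y k"
  unfolding eval_code_def using assms by (auto simp: vec_eq_iff)

lemma eval_codeE:
  assumes "v \<in> eval_code g x y k"
  obtains a b where "\<And>i. v $ i = poly a (x i) + poly b (x i) * y i"
    and "a = 0 \<or> 2 * degree a < k" "b = 0 \<or> 2 * degree b + 2 * g + 1 < k"
proof -
  from assms obtain a b where "v = (\<chi> i. poly a (x i) + poly b (x i) * y i)"
    and "a = 0 \<or> 2 * degree a < k" "b = 0 \<or> 2 * degree b + 2 * g + 1 < k"
    unfolding eval_code_def by blast
  then show ?thesis by (intro that) simp_all
qed

text \<open>The common shape of both bounds in \<open>eval_code\<close>, with \<open>d = 0\<close>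
  or \<open>d = 2 * g + 1\<close>. The separate case of the zero polynomial keeps it admissible when
  \<open>k \<le> d\<close>.\<close>

lemma degree_add_zero_or_less:
  fixes a b :: "'a::field poly"
  assumes "a = 0 \<or> c * degree a + d < (k::nat)" "b = 0 \<or> c * degree b + d < k"
  shows "a + b = 0 \<or> c * degree (a + b) + d < k"
proof (cases "a = 0 \<or> b = 0")
  case False
  have "c * degree (a + b) \<le> c * max (degree a) (degree b)"
    by (intro mult_le_mono degree_add_le_max order_refl)
  moreover have "c * max (degree a) (degree b) + d < k"
    using assms False by (simp add: max_def)
  ultimately show ?thesis by linarith
qed (use assms in auto)

lemma subspace_eval_code: "vec.subspace (eval_code g x y k)"
proof (rule vec.subspaceI)
  show "0 \<in> eval_code g x y k" by (rule eval_codeI[of _ 0 _ 0]) auto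
next
  fix v w assume "v \<in> eval_code g x y k" "w \<in> eval_code g x y k"
  then obtain a b a' b' where
    v: "\<And>i. v $ i = poly a (x i) + poly b (x i) * y i"
      "a = 0 \<or> 2 * degree a < k" "b = 0 \<or> 2 * degree b + 2 * g + 1 < k" and
    w: "\<And>i. w $ i = poly a' (x i) + poly b' (x i) * y i"
      "a' = 0 \<or> 2 * degree a' < k" "b' = 0 \<or> 2 * degree b' + 2 * g + 1 < k"
    by (metis eval_codeE)
  have "a + a' = 0 \<or> 2 * degree (a + a') < k"
    using degree_add_zero_or_less[of a 2 0 k a'] v w by simp
  moreover have "b + b' = 0 \<or> 2 * degree (b + b') + 2 * g + 1 < k"
    using degree_add_zero_or_less[of b 2 "2 * g + 1" k b'] v w by (simp add: add.assoc)
  ultimately show "v + w \<in> eval_code g x y k"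
    by (rule eval_codeI[rotated]) (simp add: v w algebra_simps)
next
  fix c v assume "v \<in> eval_code g x y k"
  then obtain a b where
    v: "\<And>i. v $ i = poly a (x i) + poly b (x i) * y i"
      "a = 0 \<or> 2 * degree a < k" "b = 0 \<or> 2 * degree b + 2 * g + 1 < k"
    by (metis eval_codeE)
  show "c *s v \<in> eval_code g x y k"
    by (rule eval_codeI[of _ "smult c a" _ "smult c b"]) (use v in \<open>auto simp: algebra_simps\<close>)
qed

lemma eval_code_mono:
  assumes "k \<le> l"
  shows "eval_code g x y k \<subseteq> eval_code g x y l"
  unfolding eval_code_def using assms by fastforce

locale curve_points =
  fixes H F :: "'a::{field,finite} poly" and g :: nat and x y :: "'n::finite \<Rightarrow> 'a"
  assumes degree_F: "degree F = 2 * g + 1" and degree_H: "degree H \<le> g"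
    and on_curve: "\<And>i. y i ^ 2 + poly H (x i) * y i = poly F (x i)"
    and points_inj: "\<And>i j. x i = x j \<Longrightarrow> y i = y j \<Longrightarrow> i = j"
begin

text \<open>By Vieta, since \<open>y i\<close> and \<open>y j\<close> are the two roots of one monic
  quadratic.\<close>

lemma conjugate_sum:
  assumes "x i = x j" "i \<noteq> j"
  shows "y i + y j = - poly H (x i)"
proof -
  have "y i ^ 2 + poly H (x i) * y i = y j ^ 2 + poly H (x i) * y j"
    using on_curve[of i] on_curve[of j] assms(1) by simp
  then have "(y i - y j) * (y i + y j + poly H (x i)) = 0"
    by (simp add: power2_eq_square algebra_simps)
  moreover have "y i \<noteq> y j" using points_inj assms by blast
  ultimately show ?thesis by (simp add: eq_neg_iff_add_eq_0)
qed

lemma eval_eq_0D: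
  assumes "\<And>i. i \<in> S \<Longrightarrow> poly a (x i) + poly b (x i) * y i = 0"
    and "a = 0 \<or> 2 * degree a < card S" "b = 0 \<or> 2 * degree b + 2 * g + 1 < card S"
  shows "a = 0 \<and> b = 0"
proof (rule zero_count[OF degree_F degree_H, where Z = "(\<lambda>i. (x i, y i)) ` S"])
  have "card ((\<lambda>i. (x i, y i)) ` S) = card S"
    by (rule card_image) (auto intro!: inj_onI points_inj)
  then show "a = 0 \<or> 2 * degree a < card ((\<lambda>i. (x i, y i)) ` S)"
    "b = 0 \<or> 2 * degree b + 2 * g + 1 < card ((\<lambda>i. (x i, y i)) ` S)"
    using assms(2,3) by simp_all
qed (use on_curve assms(1) in auto)

text \<open>
  A functional with coefficients \<open>f\<close> that kills the code yields polynomials \<open>c\<close> and \<open>e\<close> from its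
  restrictions to the functions \<open>a(x)\<close> and \<open>b(x) y\<close>. The function \<open>c y - e\<close> vanishes at every
  point of \<open>S\<close> whose conjugate is not in \<open>S\<close>, and its pole order is too small for that many zeros.
\<close>

lemma functional_killing_code_eq_0:
  assumes k: "card S + 2 * g \<le> k"
    and f: "\<And>w. w \<in> eval_code g x y k \<Longrightarrow> (\<Sum>i\<in>S. f i * w $ i) = 0"
    and i: "i \<in> S"
  shows "f i = 0"
proof -
  define U where "U = x ` S"
  define fib where "fib = (\<lambda>a. {i \<in> S. x i = a})"
  have finU: "finite U" by (simp add: U_def)
  \<comment> \<open>On functions of \<open>x\<close> alone a functional sees only its sums over the
    fibres of \<open>x\<close>.\<close>
  have group: "(\<Sum>a\<in>U. (\<Sum>i\<in>fib a. u i) * a ^ n) = (\<Sum>i\<in>S. u i * x i ^ n)"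
    for u :: "'n \<Rightarrow> 'a" and n
  proof -
    have "(\<Sum>i\<in>S. u i * x i ^ n) = (\<Sum>a\<in>U. \<Sum>i\<in>fib a. u i * x i ^ n)"
      unfolding U_def fib_def by (rule sum.image_gen) simp
    also have "\<dots> = (\<Sum>a\<in>U. \<Sum>i\<in>fib a. u i * a ^ n)"
      by (intro sum.cong) (auto simp: fib_def)
    finally show ?thesis by (simp add: sum_distrib_right)
  qed
  \<comment> \<open>\<open>A\<close> counts the \<open>n\<close> with \<open>2 * n < k\<close> and
    \<open>B\<close> those with \<open>2 * n + 2 * g + 1 < k\<close>, that is, the monomials without
    and with the factor \<open>y\<close>.\<close>
  define A where "A = (k + 1) div 2"
  define B where "B = (k - 2 * g) div 2"
  have "(\<Sum>a\<in>U. (\<Sum>i\<in>fib a. f i) * a ^ n) = 0" if "n < A" for n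
  proof -
    have "(\<chi> i. x i ^ n) \<in> eval_code g x y k"
      by (rule eval_codeI[of _ "monom 1 n" _ 0])
         (use that in \<open>auto simp: poly_monom degree_monom_eq A_def\<close>)
    from f[OF this] show ?thesis unfolding group by simp
  qed
  then obtain c where c: "\<And>a. a \<in> U \<Longrightarrow>
      poly c a = (\<Sum>i\<in>fib a. f i) * poly (lagrange_basis U a) a"
    and degc: "c = 0 \<or> degree c + A < card U"
    using functional_killing_low_degree[OF finU, of A "\<lambda>a. \<Sum>i\<in>fib a. f i"] by blast
  have "(\<Sum>a\<in>U. (\<Sum>i\<in>fib a. f i * y i) * a ^ n) = 0" if "n < B" for n
  proof -
    have "(\<chi> i. x i ^ n * y i) \<in> eval_code g x y k"
      by (rule eval_codeI[of _ 0 _ "monom 1 n"])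
         (use that in \<open>auto simp: poly_monom degree_monom_eq B_def\<close>)
    from f[OF this] show ?thesis unfolding group by (simp add: ac_simps)
  qed
  then obtain e where e: "\<And>a. a \<in> U \<Longrightarrow>
      poly e a = (\<Sum>i\<in>fib a. f i * y i) * poly (lagrange_basis U a) a"
    and dege: "e = 0 \<or> degree e + B < card U"
    using functional_killing_low_degree[OF finU, of B "\<lambda>a. \<Sum>i\<in>fib a. f i * y i"] by blast
  define S1 where "S1 = {i \<in> S. fib (x i) = {i}}"
  \<comment> \<open>A fibre with a single point is counted once in \<open>S\<close> and once in
    \<open>S1\<close>; any other fibre has at least two points in \<open>S\<close>.\<close>
  have "2 * card U \<le> card S + card S1"
  proof -
    have S: "card S = (\<Sum>a\<in>U. card (fib a))"
      using sum.image_gen[of S "\<lambda>_. 1::nat" x] by (simp add: U_def fib_def)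
    have S1: "card S1 = (\<Sum>a\<in>U. card (fib a \<inter> S1))"
    proof -
      have "card S1 = (\<Sum>i\<in>S. if i \<in> S1 then 1 else 0)"
        by (simp add: sum.If_cases S1_def Int_def)
      also have "\<dots> = (\<Sum>a\<in>U. \<Sum>i\<in>fib a. if i \<in> S1 then 1 else 0)"
        unfolding U_def fib_def by (rule sum.image_gen) simp
      also have "\<dots> = (\<Sum>a\<in>U. card (fib a \<inter> S1))"
        by (simp add: sum.If_cases Int_def)
      finally show ?thesis .
    qed
    have "2 \<le> card (fib a) + card (fib a \<inter> S1)" if a: "a \<in> U" for a
    proof -
      obtain i where i: "i \<in> fib a" using a by (auto simp: U_def fib_def)
      show ?thesis
      proof (cases "fib a = {i}")
        case True
        moreover have "x i = a" "i \<in> S" using i by (simp_all add: fib_def)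
        ultimately have "i \<in> S1" by (simp add: S1_def)
        then show ?thesis using True by simp
      next
        case False
        then obtain j where "j \<in> fib a" "j \<noteq> i" using i by blast
        then have "card {i, j} \<le> card (fib a)" using i by (intro card_mono) auto
        then show ?thesis using \<open>j \<noteq> i\<close> by simp
      qed
    qed
    then have "(\<Sum>a\<in>U. 2) \<le> (\<Sum>a\<in>U. card (fib a) + card (fib a \<inter> S1))" by (rule sum_mono)
    then show ?thesis using S S1 by (simp add: sum.distrib)
  qed
  \<comment> \<open>Here \<open>k\<close> exceeds \<open>card S\<close> by enough:
    \<open>2 * A \<ge> k\<close> and \<open>2 * B \<ge> k - 2 * g - 1\<close>.\<close>
  then have "- e = 0 \<or> 2 * degree (- e) < card S1" "c = 0 \<or> 2 * degree c + 2 * g + 1 < card S1"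
    using k degc dege by (auto simp: A_def B_def)
  moreover have "poly (- e) (x i) + poly c (x i) * y i = 0" if "i \<in> S1" for i
  proof -
    have "fib (x i) = {i}" "x i \<in> U" using that by (auto simp: S1_def U_def)
    then show ?thesis using c[of "x i"] e[of "x i"] by simp
  qed
  ultimately have "- e = 0 \<and> c = 0" by (intro eval_eq_0D)
  \<comment> \<open>On a fibre with two points these equations form a Vandermonde system in the
    distinct nodes \<open>y i\<close> and \<open>y j\<close>.\<close>
  then have sums: "(\<Sum>j\<in>fib (x i). f j) = 0" "(\<Sum>j\<in>fib (x i). f j * y j) = 0"
    using c[of "x i"] e[of "x i"] i poly_lagrange_basis_self_nonzero[OF finU] by (auto simp: U_def)
  show ?thesis
  proof (cases "fib (x i) = {i}")
    case True
    then show ?thesis using sums by simp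
  next
    case False
    then obtain j where j: "j \<in> S" "x j = x i" "j \<noteq> i" using i by (auto simp: fib_def)
    have "l = i \<or> l = j" if "x l = x i" for l
    proof (rule ccontr)
      assume "\<not> (l = i \<or> l = j)"
      then have "y i + y l = y i + y j"
        using conjugate_sum[of i l] conjugate_sum[of i j] j that by auto
      then show False using points_inj[of l j] j that \<open>\<not> (l = i \<or> l = j)\<close> by auto
    qed
    then have "fib (x i) = {i, j}" using i j by (auto simp: fib_def)
    then have "f j = - f i" "f i * y i + f j * y j = 0"
      using sums j by (auto simp: eq_neg_iff_add_eq_0 add.commute)
    then have "f i * (y i - y j) = 0" by (simp add: algebra_simps)
    moreover have "y i \<noteq> y j" using points_inj j by metis
    ultimately show ?thesis by simp
  qed
qed

text \<open>The hypothesis is the nonspecial range of Riemann-Roch. The vectors agreeing on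
  \<open>S\<close> with a codeword form a subspace containing the axis vectors outside
  \<open>S\<close>, so a functional killing it lives on \<open>S\<close> and
  \<open>functional_killing_code_eq_0\<close> applies.\<close>

lemma eval_code_surj_on:
  assumes k: "card S + 2 * g \<le> k"
  obtains w where "w \<in> eval_code g x y k" "\<And>i. i \<in> S \<Longrightarrow> w $ i = t $ i"
proof -
  define W where "W = {v :: 'a ^ 'n. \<exists>w\<in>eval_code g x y k. \<forall>i\<in>S. w $ i = v $ i}"
  note sub = subspace_eval_code[of g x y k]
  have "W = UNIV"
  proof (rule subspace_eq_UNIV_if_annihilator_trivial)
    show "vec.subspace W"
    proof (rule vec.subspaceI)
      show "0 \<in> W" unfolding W_def using vec.subspace_0[OF sub] by (auto intro: bexI[of _ 0])
    next
      fix v v' assume "v \<in> W" "v' \<in> W"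
      then obtain w w' where "w \<in> eval_code g x y k" "\<forall>i\<in>S. w $ i = v $ i"
        "w' \<in> eval_code g x y k" "\<forall>i\<in>S. w' $ i = v' $ i" by (auto simp: W_def)
      then show "v + v' \<in> W"
        unfolding W_def by (auto intro!: bexI[of _ "w + w'"] vec.subspace_add[OF sub])
    next
      fix c v assume "v \<in> W"
      then obtain w where "w \<in> eval_code g x y k" "\<forall>i\<in>S. w $ i = v $ i" by (auto simp: W_def)
      then show "c *s v \<in> W"
        unfolding W_def by (auto intro!: bexI[of _ "c *s w"] vec.subspace_scale[OF sub])
    qed
  next
    fix f :: "'a ^ 'n" assume f: "\<And>w. w \<in> W \<Longrightarrow> (\<Sum>i\<in>UNIV. f $ i * w $ i) = 0"
    have out: "f $ i = 0" if "i \<notin> S" for i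
    proof -
      have "axis i 1 \<in> W"
        unfolding W_def using that vec.subspace_0[OF sub] by (auto simp: axis_def intro!: bexI[of _ 0])
      from f[OF this] show ?thesis
        by (simp add: axis_def if_distrib cong: if_cong)
    qed
    have "f $ i = 0" if "i \<in> S" for i
    proof (rule functional_killing_code_eq_0[OF k _ that])
      fix w assume "w \<in> eval_code g x y k"
      then have "(\<Sum>i\<in>UNIV. f $ i * w $ i) = 0" by (intro f) (auto simp: W_def)
      moreover have "(\<Sum>i\<in>UNIV. f $ i * w $ i) = (\<Sum>i\<in>S. f $ i * w $ i)"
        by (rule sum.mono_neutral_right) (auto simp: out)
      ultimately show "(\<Sum>i\<in>S. f $ i * w $ i) = 0" by simp
    qed
    then show "f = 0" using out by (auto simp: vec_eq_iff)
  qed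
  then show ?thesis using that unfolding W_def by blast
qed

end

section \<open>The scheme\<close>

lemma lagrange_basis_mult_factor:
  assumes "finite U" "u \<in> U"
  shows "[:- u, 1:] * lagrange_basis U u = (\<Prod>z\<in>U. [:- z, 1:])"
  unfolding lagrange_basis_def using assms by (rule prod.remove[symmetric])

text \<open>Clearing denominators: \<open>p\<close> is the numerator of a sum of simple fractions,
  and its values at the poles recover the coefficients.\<close>

lemma partial_fractions:
  fixes \<gamma> f :: "nat \<Rightarrow> 'a::field"
  assumes I: "finite I" and inj: "inj_on \<gamma> I"
  defines "U \<equiv> \<gamma> ` I"
  defines "p \<equiv> \<Sum>j\<in>I. smult (f j) (lagrange_basis U (\<gamma> j))"
  shows "k \<in> I \<Longrightarrow> poly p (\<gamma> k) = f k * poly (lagrange_basis U (\<gamma> k)) (\<gamma> k)"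
    and "p = 0 \<or> degree p < card I"
    and "z \<notin> U \<Longrightarrow> poly p z = poly (\<Prod>u\<in>U. [:- u, 1:]) z * (\<Sum>j\<in>I. f j / (z - \<gamma> j))"
proof -
  let ?f = "\<lambda>u. f (the_inv_into I \<gamma> u)"
  have finU: "finite U" using I by (simp add: U_def)
  have f: "?f (\<gamma> j) = f j" if "j \<in> I" for j using the_inv_into_f_f[OF inj that] by simp
  have p: "p = (\<Sum>u\<in>U. smult (?f u) (lagrange_basis U u))"
    unfolding p_def by (subst (2) U_def) (simp add: sum.reindex[OF inj] f)
  show "poly p (\<gamma> k) = f k * poly (lagrange_basis U (\<gamma> k)) (\<gamma> k)" if "k \<in> I"
    unfolding p using poly_lagrange_sum[OF finU, of "\<gamma> k" ?f] that by (simp add: U_def f)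
  have "card U = card I" unfolding U_def by (rule card_image[OF inj])
  then show "p = 0 \<or> degree p < card I"
    using degree_lagrange_sum_less[OF finU, of ?f] unfolding p by (cases "U = {}") auto
  show "poly p z = poly (\<Prod>u\<in>U. [:- u, 1:]) z * (\<Sum>j\<in>I. f j / (z - \<gamma> j))" if z: "z \<notin> U"
  proof -
    have "f j * poly (lagrange_basis U (\<gamma> j)) z
        = poly (\<Prod>u\<in>U. [:- u, 1:]) z * (f j / (z - \<gamma> j))" if "j \<in> I" for j
    proof -
      have "\<gamma> j \<in> U" "z \<noteq> \<gamma> j" using that z by (auto simp: U_def)
      have "poly (\<Prod>u\<in>U. [:- u, 1:]) z = (z - \<gamma> j) * poly (lagrange_basis U (\<gamma> j)) z"
        by (simp only: lagrange_basis_mult_factor[OF finU \<open>\<gamma> j \<in> U\<close>, symmetric] poly_mult)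
           (simp add: algebra_simps)
      then show ?thesis using \<open>z \<noteq> \<gamma> j\<close> by simp
    qed
    then show ?thesis by (simp add: p_def poly_sum sum_distrib_left)
  qed
qed

text \<open>Translation by \<open>c' - c + z\<close>, with noise \<open>z\<close> equal to
  \<open>c - c'\<close> on \<open>S\<close>, carries the coset of \<open>c\<close> bijectively to
  that of \<open>c'\<close> and leaves the shares in \<open>S\<close> unchanged.\<close>

lemma lsss_secureI:
  fixes C Cnoise :: "('a::{field,finite} ^ 'n::finite) set"
  assumes sub: "vec.subspace Cnoise"
    and surj: "\<And>S t. card S = T \<Longrightarrow> \<exists>z\<in>Cnoise. \<forall>i\<in>S. z $ i = (t :: 'a ^ 'n) $ i"
  shows "lsss_secure T (C, Cnoise)"
  unfolding lsss_secure_def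
proof (clarify)
  fix S :: "'n set" and c c' :: "'a ^ 'n" assume "T = card S"
  then obtain z where z: "z \<in> Cnoise" "\<forall>i\<in>S. z $ i = (c - c') $ i"
    using surj[of S "c - c'"] by blast
  define f where "f = (\<lambda>v. v + (c' - c + z))"
  have "f ` share_vectors Cnoise c = share_vectors Cnoise c'"
  proof -
    have "(\<lambda>w. w + z) ` Cnoise = Cnoise"
    proof (intro equalityI subsetI)
      fix w assume "w \<in> Cnoise"
      then have "w - z \<in> Cnoise" using vec.subspace_diff[OF sub] z by blast
      then show "w \<in> (\<lambda>w. w + z) ` Cnoise" by (rule rev_image_eqI) simp
    qed (use vec.subspace_add[OF sub] z in auto)
    moreover have "f ` share_vectors Cnoise c = (\<lambda>w. c' + w) ` (\<lambda>w. w + z) ` Cnoise"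
      by (simp add: share_vectors_def f_def image_image algebra_simps)
    ultimately show ?thesis by (simp add: share_vectors_def)
  qed
  moreover have "map_pmf f (pmf_of_set (share_vectors Cnoise c))
      = pmf_of_set (f ` share_vectors Cnoise c)"
    using z(1) by (intro map_pmf_of_set_inj) (auto simp: f_def share_vectors_def inj_on_def)
  ultimately have "pmf_of_set (share_vectors Cnoise c') = map_pmf f (pmf_of_set (share_vectors Cnoise c))"
    by simp
  then have "share_distribution Cnoise S c'
      = map_pmf (\<lambda>v. restrict (\<lambda>n. f v $ n) S) (pmf_of_set (share_vectors Cnoise c))"
    by (simp add: share_distribution_def map_pmf_comp)
  also have "(\<lambda>v. restrict (\<lambda>n. f v $ n) S) = (\<lambda>v. restrict (\<lambda>n. v $ n) S)"
    using z(2) by (auto simp: f_def restrict_def fun_eq_iff)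
  finally show "share_distribution Cnoise S c = share_distribution Cnoise S c'"
    unfolding share_distribution_def by (rule sym)
qed

lemma dim_span_singleton:
  fixes v :: "'a::field ^ 'n::finite"
  assumes "v \<noteq> 0"
  shows "vec.dim (vec.span {v}) = 1"
proof -
  have "vec.independent {v}" using assms by simp
  from vec.dim_span_eq_card_independent[OF this] show ?thesis by simp
qed

definition scaled_code :: "('n \<Rightarrow> 'a::field) \<Rightarrow> ('a ^ 'n::finite) set \<Rightarrow> ('a ^ 'n) set" where
  "scaled_code u W = (\<lambda>v. \<chi> i. u i * v $ i) ` W"

lemma subspace_scaled_code:
  assumes W: "vec.subspace W"
  shows "vec.subspace (scaled_code u W)"
proof (rule vec.subspaceI)
  show "0 \<in> scaled_code u W"
    unfolding scaled_code_def using vec.subspace_0[OF W] by (intro rev_image_eqI) (auto simp: vec_eq_iff)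
next
  fix v w assume "v \<in> scaled_code u W" "w \<in> scaled_code u W"
  then obtain v' w' where "v' \<in> W" "w' \<in> W" "v = (\<chi> i. u i * v' $ i)" "w = (\<chi> i. u i * w' $ i)"
    by (auto simp: scaled_code_def)
  then show "v + w \<in> scaled_code u W"
    unfolding scaled_code_def
    by (intro rev_image_eqI[of "v' + w'"] vec.subspace_add[OF W]) (auto simp: vec_eq_iff algebra_simps)
next
  fix c v assume "v \<in> scaled_code u W"
  then obtain v' where "v' \<in> W" "v = (\<chi> i. u i * v' $ i)" by (auto simp: scaled_code_def)
  then show "c *s v \<in> scaled_code u W"
    unfolding scaled_code_def
    by (intro rev_image_eqI[of "c *s v'"] vec.subspace_scale[OF W]) (auto simp: vec_eq_iff)
qed

section \<open>The scheme and its interference space\<close>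

text \<open>
  The fragments \<open>l\<close> and \<open>l + J\<close> share the pole \<open>\<gamma> l\<close>; the former is decoded from \<open>1 / (x - \<gamma> l)\<close>,
  the latter from \<open>y / (x - \<gamma> l)\<close>.
\<close>

definition csa_pole :: "nat \<Rightarrow> (nat \<Rightarrow> 'a) \<Rightarrow> nat \<Rightarrow> 'a" where
  "csa_pole J \<gamma> l = \<gamma> (if l \<le> J then l else l - J)"

text \<open>The noise bounds are the least ones to which \<open>eval_code_surj_on\<close> applies
  for \<open>K\<close> resp. \<open>T\<close> positions. Scaling the query noise cancels the pole of
  the storage vector in the product.\<close>

definition csa_scheme ::
    "nat \<Rightarrow> ('n::finite \<Rightarrow> 'a::field) \<Rightarrow> ('n \<Rightarrow> 'a) \<Rightarrow> (nat \<Rightarrow> 'a) \<Rightarrow> nat \<Rightarrow> nat \<Rightarrow> nat \<Rightarrow> nat \<Rightarrow> ('a, 'n) pir"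
  where
  "csa_scheme g x y \<gamma> J L K T =
    \<lparr>num_fragments = L,
     storage_vec = (\<lambda>l. \<chi> i. 1 / (x i - csa_pole J \<gamma> l)),
     storage_noise = (\<lambda>l. eval_code g x y (K + 2 * g)),
     query_vec = (\<lambda>l. \<chi> i. if l \<le> J then 1 else y i),
     query_noise = (\<lambda>l. scaled_code (\<lambda>i. x i - csa_pole J \<gamma> l) (eval_code g x y (T + 2 * g)))\<rparr>"

text \<open>Pole orders add, and \<open>y * y = F - H * y\<close> removes the square of
  \<open>y\<close>. The \<open>+ 1\<close> arises because all bounds are strict.\<close>

lemma (in curve_points) eval_code_mult:
  assumes v: "v \<in> eval_code g x y k" and w: "w \<in> eval_code g x y l" and m: "k + l \<le> m + 1"
  shows "(\<chi> i. v $ i * w $ i) \<in> eval_code g x y m"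
proof -
  from v obtain a b where
    v: "\<And>i. v $ i = poly a (x i) + poly b (x i) * y i"
      "a = 0 \<or> 2 * degree a < k" "b = 0 \<or> 2 * degree b + 2 * g + 1 < k"
    by (metis eval_codeE)
  from w obtain a' b' where
    w: "\<And>i. w $ i = poly a' (x i) + poly b' (x i) * y i"
      "a' = 0 \<or> 2 * degree a' < l" "b' = 0 \<or> 2 * degree b' + 2 * g + 1 < l"
    by (metis eval_codeE)
  have aa: "a * a' = 0 \<or> 2 * degree (a * a') + 0 < m"
    using v(2) w(2) m degree_mult_le[of a a'] by fastforce
  have bbF: "b * b' * F = 0 \<or> 2 * degree (b * b' * F) + 0 < m"
    using v(3) w(3) m degree_mult_le[of "b * b'" F] degree_mult_le[of b b'] degree_F by fastforce
  have ab: "a * b' = 0 \<or> 2 * degree (a * b') + (2 * g + 1) < m"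
    using v(2) w(3) m degree_mult_le[of a b'] by fastforce
  have ba: "b * a' = 0 \<or> 2 * degree (b * a') + (2 * g + 1) < m"
    using v(3) w(2) m degree_mult_le[of b a'] by fastforce
  have bbH: "- (b * b' * H) = 0 \<or> 2 * degree (- (b * b' * H)) + (2 * g + 1) < m"
    using v(3) w(3) m degree_mult_le[of "b * b'" H] degree_mult_le[of b b'] degree_H by fastforce
  show ?thesis
  proof (rule eval_codeI)
    show "a * a' + b * b' * F = 0 \<or> 2 * degree (a * a' + b * b' * F) < m"
      using degree_add_zero_or_less[OF aa bbF] by simp
    show "a * b' + b * a' + - (b * b' * H) = 0
        \<or> 2 * degree (a * b' + b * a' + - (b * b' * H)) + 2 * g + 1 < m"
      using degree_add_zero_or_less[OF degree_add_zero_or_less[OF ab ba] bbH] by (simp add: add.assoc)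
  next
    fix i
    have F: "poly F (x i) = y i * y i + poly H (x i) * y i"
      using on_curve[of i] by (simp add: power2_eq_square)
    show "(\<chi> i. v $ i * w $ i) $ i = poly (a * a' + b * b' * F) (x i)
        + poly (a * b' + b * a' + - (b * b' * H)) (x i) * y i"
      by (simp add: v(1) w(1) F algebra_simps)
  qed
qed

text \<open>\<open>enough_points\<close> leaves room for interference multiplied by the product of
  all \<open>x - \<gamma> j\<close>, whose pole order is \<open>2 * J\<close>.\<close>

locale csa_points = curve_points H F g x y
  for H F :: "'a::{field,finite} poly" and g :: nat and x y :: "'n::finite \<Rightarrow> 'a" +
  fixes \<gamma> :: "nat \<Rightarrow> 'a" and J L K T :: nat
  assumes g_pos: "g \<ge> 1" and poles_inj: "inj_on \<gamma> {1..J}"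
    and x_neq_pole: "\<And>i j. j \<in> {1..J} \<Longrightarrow> x i \<noteq> \<gamma> j"
    and y_nonzero: "\<And>i. y i \<noteq> 0"
    and L_le: "L \<le> 2 * J"
    and enough_points: "2 * J + K + T + 4 * g + 1 \<le> CARD('n)"
begin

abbreviation "pole \<equiv> csa_pole J \<gamma>"
abbreviation "qvec l i \<equiv> if l \<le> J then 1 else y i"
text \<open>The bound is dictated by the product of both noise terms with \<open>x - pole l\<close>:
  strict bounds \<open>K + 2 * g\<close>, \<open>T + 2 * g\<close> and \<open>3\<close>, less one
  for each of the two multiplications.\<close>

abbreviation "interference \<equiv> eval_code g x y (K + T + 4 * g + 1)"
abbreviation "scheme \<equiv> csa_scheme g x y \<gamma> J L K T"

lemma x_neq_csa_pole:
  assumes "l \<in> {1..L}"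
  shows "x i - pole l \<noteq> 0"
proof -
  have "(if l \<le> J then l else l - J) \<in> {1..J}" using assms L_le by auto
  from x_neq_pole[OF this] show ?thesis unfolding csa_pole_def by simp
qed

text \<open>Multiplied by \<open>h\<close>, the relation says that a function with fewer poles than
  servers vanishes at all servers. Hence \<open>h\<close> divides the numerators \<open>p\<close>
  and \<open>q\<close>, which therefore vanish at the poles.\<close>

lemma targets_independent:
  assumes v: "v \<in> interference"
    and eq: "\<And>i. (\<Sum>l=1..L. f l * (qvec l i / (x i - pole l))) = v $ i"
    and l: "l \<in> {1..L}"
  shows "f l = 0"
proof -
  \<comment> \<open>Extension by zero makes the indices up to \<open>2 * J\<close> fall into two
    blocks of length \<open>J\<close>, without and with the factor \<open>y\<close>.\<close>
  define f' where "f' = (\<lambda>l. if l \<in> {1..L} then f l else 0)"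
  define U where "U = \<gamma> ` {1..J}"
  define h where "h = (\<Prod>u\<in>U. [:- u, 1:])"
  define p where "p = (\<Sum>j=1..J. smult (f' j) (lagrange_basis U (\<gamma> j)))"
  define q where "q = (\<Sum>j=1..J. smult (f' (j + J)) (lagrange_basis U (\<gamma> j)))"
  note pf = partial_fractions[OF finite_atLeastAtMost poles_inj, folded U_def, folded h_def]
  from v obtain a b where
    v: "\<And>i. v $ i = poly a (x i) + poly b (x i) * y i"
      "a = 0 \<or> 2 * degree a < K + T + 4 * g + 1"
      "b = 0 \<or> 2 * degree b + 2 * g + 1 < K + T + 4 * g + 1"
    by (metis eval_codeE)
  have degh: "degree h = J"
  proof -
    have "degree h = (\<Sum>u\<in>U. degree [:- u, 1:])"
      unfolding h_def by (rule degree_prod_sum_eq) simp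
    then show ?thesis using card_image[OF poles_inj] by (simp add: U_def)
  qed
  have split: "(\<Sum>j=1..J. f' j / (x i - \<gamma> j)) + (\<Sum>j=1..J. f' (j + J) / (x i - \<gamma> j)) * y i = v $ i" for i
  proof -
    let ?t = "\<lambda>l. f' l * (qvec l i / (x i - pole l))"
    have "v $ i = (\<Sum>l=1..L. ?t l)" unfolding eq[symmetric] by (simp add: f'_def)
    also have "\<dots> = (\<Sum>l=1..2 * J. ?t l)"
      using L_le by (intro sum.mono_neutral_left) (auto simp: f'_def)
    also have "\<dots> = (\<Sum>l=1..J. ?t l) + (\<Sum>l=J+1..J+J. ?t l)"
      unfolding mult_2 by (rule sum.ub_add_nat) simp
    also have "(\<Sum>l=J+1..J+J. ?t l) = (\<Sum>j=1..J. ?t (j + J))"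
      using sum.shift_bounds_cl_nat_ivl[of ?t 1 J J] by (simp add: add.commute)
    also have "\<dots> = (\<Sum>j=1..J. f' (j + J) / (x i - \<gamma> j)) * y i"
      by (simp add: csa_pole_def sum_distrib_right)
    also have "(\<Sum>l=1..J. ?t l) = (\<Sum>j=1..J. f' j / (x i - \<gamma> j))"
      by (simp add: csa_pole_def)
    finally show ?thesis by simp
  qed
  have "p + - (h * a) = 0 \<and> q + - (h * b) = 0"
  proof (rule eval_eq_0D)
    fix i
    have "x i \<notin> U" using x_neq_pole by (auto simp: U_def)
    then have "poly p (x i) = poly h (x i) * (\<Sum>j=1..J. f' j / (x i - \<gamma> j))"
      "poly q (x i) = poly h (x i) * (\<Sum>j=1..J. f' (j + J) / (x i - \<gamma> j))"
      unfolding p_def q_def by (rule pf(3))+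
    then have "poly (p + - (h * a)) (x i) + poly (q + - (h * b)) (x i) * y i
      = poly h (x i) * ((\<Sum>j=1..J. f' j / (x i - \<gamma> j))
          + (\<Sum>j=1..J. f' (j + J) / (x i - \<gamma> j)) * y i - v $ i)"
      by (simp add: v(1) algebra_simps)
    then show "poly (p + - (h * a)) (x i) + poly (q + - (h * b)) (x i) * y i = 0"
      by (simp only: split diff_self mult_zero_right)
  next
    have "p = 0 \<or> 2 * degree p + 0 < CARD('n)"
      using pf(2)[where f = f'] enough_points by (auto simp: p_def)
    moreover have "- (h * a) = 0 \<or> 2 * degree (- (h * a)) + 0 < CARD('n)"
      using v(2) degree_mult_le[of h a] degh enough_points by fastforce
    ultimately have "p + - (h * a) = 0 \<or> 2 * degree (p + - (h * a)) + 0 < CARD('n)"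
      by (rule degree_add_zero_or_less)
    then show "p + - (h * a) = 0 \<or> 2 * degree (p + - (h * a)) < CARD('n)"
      by simp
  next
    have "q = 0 \<or> 2 * degree q + (2 * g + 1) < CARD('n)"
      using pf(2)[where f = "\<lambda>j. f' (j + J)"] enough_points by (auto simp: q_def)
    moreover have "- (h * b) = 0 \<or> 2 * degree (- (h * b)) + (2 * g + 1) < CARD('n)"
      using v(3) degree_mult_le[of h b] degh enough_points by fastforce
    ultimately have "q + - (h * b) = 0 \<or> 2 * degree (q + - (h * b)) + (2 * g + 1) < CARD('n)"
      by (rule degree_add_zero_or_less)
    then show "q + - (h * b) = 0 \<or> 2 * degree (q + - (h * b)) + 2 * g + 1 < CARD('n)"
      by (simp add: add.assoc)
  qed
  then have pq: "p = h * a" "q = h * b" by (simp_all add: eq_neg_iff_add_eq_0)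
  have zero: "f' j = 0 \<and> f' (j + J) = 0" if j: "j \<in> {1..J}" for j
  proof -
    have "finite U" "\<gamma> j \<in> U" using j by (auto simp: U_def)
    then have "poly h (\<gamma> j) = 0" by (auto simp: h_def poly_prod intro!: prod_zero)
    then have "poly p (\<gamma> j) = 0" "poly q (\<gamma> j) = 0" by (simp_all add: pq)
    then show ?thesis
      using pf(1)[OF j, where f = f'] pf(1)[OF j, where f = "\<lambda>j. f' (j + J)"]
        poly_lagrange_basis_self_nonzero[OF \<open>finite U\<close>, of "\<gamma> j"]
      by (simp add: p_def q_def)
  qed
  have "f' l = 0"
  proof (cases "l \<le> J")
    case True
    then show ?thesis using zero[of l] l by simp
  next
    case False
    then have "l - J \<in> {1..J}" using l L_le by auto
    then show ?thesis using zero[of "l - J"] False by simp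
  qed
  then show ?thesis using l by (simp add: f'_def)
qed

text \<open>The case of one coefficient, from which the trivial intersection of code and noise
  follows for storage and queries.\<close>

lemma target_notin_interference:
  assumes "v \<in> interference" "l \<in> {1..L}" "\<And>i. c * (qvec l i / (x i - pole l)) = v $ i"
  shows "c = 0"
proof -
  have "(\<lambda>m. if m = l then c else 0) l = 0"
  proof (rule targets_independent[where f = "\<lambda>m. if m = l then c else 0", OF assms(1) _ assms(2)])
    fix i
    have "(\<Sum>m=1..L. (if m = l then c else 0) * (qvec m i / (x i - pole m)))
        = (\<Sum>m=1..L. if m = l then c * (qvec l i / (x i - pole l)) else 0)"
      by (intro sum.cong) auto
    also have "\<dots> = c * (qvec l i / (x i - pole l))"
      using assms(2) by (subst sum.delta) simp_all
    finally show "(\<Sum>m=1..L. (if m = l then c else 0) * (qvec m i / (x i - pole m))) = v $ i"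
      using assms(3) by simp
  qed
  then show ?thesis by simp
qed

lemma storage_is_lsss:
  assumes l: "l \<in> {1..L}"
  shows "is_lsss (storage_lsss scheme l)"
proof -
  have "c = 0" if c: "c *s storage_vec scheme l \<in> storage_noise scheme l" for c
  proof -
    \<comment> \<open>The storage vector never carries the factor \<open>y\<close>, so it is the
      target of the index in the first block with the same pole.\<close>
    define l' where "l' = (if l \<le> J then l else l - J)"
    have l': "l' \<in> {1..L}" "l' \<le> J" "pole l' = pole l" using l L_le by (auto simp: l'_def csa_pole_def)
    have "c *s storage_vec scheme l \<in> interference"
      using c eval_code_mono[of "K + 2 * g" "K + T + 4 * g + 1" g x y] by (auto simp: csa_scheme_def)
    then show "c = 0"
      by (rule target_notin_interference[OF _ l'(1)]) (simp add: l' csa_scheme_def)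
  qed
  moreover have "vec.subspace (storage_noise scheme l)"
    by (simp add: csa_scheme_def subspace_eval_code)
  ultimately show ?thesis
    using vec.subspace_span[of "{storage_vec scheme l}"]
    by (auto simp: is_lsss_def storage_lsss_def vec.span_singleton vec.subspace_0)
qed

lemma query_is_lsss:
  assumes l: "l \<in> {1..L}"
  shows "is_lsss (query_lsss scheme l)"
proof -
  have "c = 0" if "c *s query_vec scheme l \<in> query_noise scheme l" for c
  proof -
    from that obtain z where z: "z \<in> eval_code g x y (T + 2 * g)"
      and eq: "c *s query_vec scheme l = (\<chi> i. (x i - pole l) * z $ i)"
      by (auto simp: csa_scheme_def scaled_code_def)
    have "z \<in> interference"
      using z eval_code_mono[of "T + 2 * g" "K + T + 4 * g + 1" g x y] by auto
    then show "c = 0"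
    proof (rule target_notin_interference[OF _ l])
      fix i
      have "c * qvec l i = (x i - pole l) * z $ i"
        using arg_cong[OF eq, of "\<lambda>v. v $ i"] by (simp add: csa_scheme_def)
      then have "z $ i = c * qvec l i / (x i - pole l)"
        using x_neq_csa_pole[OF l, of i] by simp
      then show "c * (qvec l i / (x i - pole l)) = z $ i" by simp
    qed
  qed
  moreover have "vec.subspace (query_noise scheme l)"
    by (simp add: csa_scheme_def subspace_eval_code subspace_scaled_code)
  ultimately show ?thesis
    using vec.subspace_span[of "{query_vec scheme l}"]
    by (auto simp: is_lsss_def query_lsss_def vec.span_singleton vec.subspace_0)
qed

lemma storage_vec_nonzero: "l \<in> {1..L} \<Longrightarrow> storage_vec scheme l \<noteq> 0"
  using x_neq_csa_pole by (auto simp: csa_scheme_def vec_eq_iff)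

lemma query_vec_nonzero: "query_vec scheme l \<noteq> 0"
  using y_nonzero by (auto simp: csa_scheme_def vec_eq_iff)

section \<open>Security, privacy and decoding\<close>

lemma scheme_secure: "pir_secure K scheme"
  unfolding pir_secure_def storage_lsss_def
proof (intro ballI lsss_secureI)
  fix l and S :: "'n set" and t :: "'a ^ 'n" assume "card S = K"
  then obtain w where "w \<in> eval_code g x y (K + 2 * g)" "\<And>i. i \<in> S \<Longrightarrow> w $ i = t $ i"
    using eval_code_surj_on[of S "K + 2 * g" t] by (metis order_refl)
  then show "\<exists>z\<in>storage_noise scheme l. \<forall>i\<in>S. z $ i = t $ i"
    unfolding csa_scheme_def by (intro bexI[of _ w]) simp_all
qed (simp add: csa_scheme_def subspace_eval_code)

lemma scheme_private: "pir_private T scheme"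
  unfolding pir_private_def query_lsss_def
proof (intro ballI lsss_secureI)
  fix l and S :: "'n set" and t :: "'a ^ 'n"
  assume "card S = T" and "l \<in> {1..num_fragments scheme}"
  then have l: "l \<in> {1..L}" by (simp add: csa_scheme_def)
  obtain w where "w \<in> eval_code g x y (T + 2 * g)"
    "\<And>i. i \<in> S \<Longrightarrow> w $ i = (\<chi> i. t $ i / (x i - pole l)) $ i"
    using eval_code_surj_on[of S "T + 2 * g" "\<chi> i. t $ i / (x i - pole l)"] \<open>card S = T\<close> by auto
  then show "\<exists>z\<in>query_noise scheme l. \<forall>i\<in>S. z $ i = t $ i"
    using x_neq_csa_pole[OF l] by (auto simp: csa_scheme_def scaled_code_def intro!: bexI[of _ w])
qed (simp add: csa_scheme_def subspace_eval_code subspace_scaled_code)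

text \<open>Of the four terms of the expanded product only the one without noise keeps its pole; in
  \<open>s * z\<close> the factor \<open>x - pole l\<close> has cancelled.\<close>

lemma noisy_product:
  assumes l: "l \<in> {1..L}"
    and s: "s_hat \<in> share_vectors (storage_noise scheme l) (s *s storage_vec scheme l)"
    and q: "q_hat \<in> share_vectors (query_noise scheme l) (d *s query_vec scheme l)"
  shows "\<exists>e\<in>interference. \<forall>i. s_hat $ i * q_hat $ i = d * s * (qvec l i / (x i - pole l)) + e $ i"
proof -
  from s obtain u where u: "u \<in> eval_code g x y (K + 2 * g)"
    and s_hat: "\<And>i. s_hat $ i = s / (x i - pole l) + u $ i"
    by (auto simp: csa_scheme_def share_vectors_def)
  from q obtain z where z: "z \<in> eval_code g x y (T + 2 * g)"
    and q_hat: "\<And>i. q_hat $ i = d * qvec l i + (x i - pole l) * z $ i"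
    by (auto simp: csa_scheme_def share_vectors_def scaled_code_def)
  have "(\<chi> i. qvec l i) \<in> eval_code g x y (2 * g + 2)"
  proof (cases "l \<le> J")
    case True
    then show ?thesis by (intro eval_codeI[of _ 1 _ 0]) auto
  next
    case False
    then show ?thesis by (intro eval_codeI[of _ 0 _ 1]) auto
  qed
  from eval_code_mult[OF this u, of "K + T + 4 * g + 1"]
  have 1: "(\<chi> i. qvec l i * u $ i) \<in> interference" by simp
  have 2: "z \<in> interference"
    using z eval_code_mono[of "T + 2 * g" "K + T + 4 * g + 1" g x y] by auto
  \<comment> \<open>By \<open>g_pos\<close> the subtraction is not truncated, even for
    \<open>K = T = 0\<close>.\<close>
  have "(\<chi> i. z $ i * u $ i) \<in> eval_code g x y (K + T + 4 * g - 1)"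
    using g_pos by (intro eval_code_mult[OF z u]) simp
  moreover have "(\<chi> i. x i - pole l) \<in> eval_code g x y 3"
    by (rule eval_codeI[of _ "[:- pole l, 1:]" _ 0]) auto
  ultimately have 3: "(\<chi> i. (x i - pole l) * (z $ i * u $ i)) \<in> interference"
    using eval_code_mult[of "\<chi> i. x i - pole l" 3 "\<chi> i. z $ i * u $ i" "K + T + 4 * g - 1"
        "K + T + 4 * g + 1"] g_pos by simp
  define e where "e = d *s (\<chi> i. qvec l i * u $ i) + s *s z + (\<chi> i. (x i - pole l) * (z $ i * u $ i))"
  have "e \<in> interference"
    unfolding e_def using 1 2 3 subspace_eval_code[of g x y]
    by (intro vec.subspace_add vec.subspace_scale)
  moreover have "s_hat $ i * q_hat $ i = d * s * (qvec l i / (x i - pole l)) + e $ i" for i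
  proof -
    have "s_hat $ i * q_hat $ i = d * s * (qvec l i / (x i - pole l)) + d * (qvec l i * u $ i)
        + s * z $ i * ((x i - pole l) / (x i - pole l)) + (x i - pole l) * (z $ i * u $ i)"
      unfolding s_hat q_hat
      by (simp only: distrib_left distrib_right times_divide_eq_left times_divide_eq_right ac_simps)
    then show ?thesis using x_neq_csa_pole[OF l, of i] by (simp add: e_def)
  qed
  ultimately show ?thesis by blast
qed

text \<open>The query coefficients remove the targets of all files but \<open>mu\<close>, and the
  noise contributions add up inside a subspace.\<close>

lemma response_eq:
  assumes mu: "mu \<in> {1..M}"
    and s: "storage_outcome scheme M s s_hat" and q: "query_outcome scheme M mu q_hat"
  shows "\<exists>v\<in>interference. \<forall>i. response scheme M s_hat q_hat $ i
    = (\<Sum>l=1..L. s mu l * (qvec l i / (x i - pole l))) + v $ i"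
proof -
  have "\<forall>l\<in>{1..L}. \<forall>m\<in>{1..M}. \<exists>e\<in>interference. \<forall>i. s_hat m l $ i * q_hat m l $ i
      = (if m = mu then 1 else 0) * s m l * (qvec l i / (x i - pole l)) + e $ i"
  proof (intro ballI noisy_product)
    fix l m assume "l \<in> {1..L}" "m \<in> {1..M}"
    moreover from this have "l \<in> {1..num_fragments scheme}" by (simp add: csa_scheme_def)
    ultimately show "l \<in> {1..L}"
      "s_hat m l \<in> share_vectors (storage_noise scheme l) (s m l *s storage_vec scheme l)"
      "q_hat m l \<in> share_vectors (query_noise scheme l) ((if m = mu then 1 else 0) *s query_vec scheme l)"
      using s q unfolding storage_outcome_def query_outcome_def by blast+
  qed
  then obtain e where e: "\<And>l m. l \<in> {1..L} \<Longrightarrow> m \<in> {1..M} \<Longrightarrow> e l m \<in> interference"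
    and prod: "\<And>l m i. l \<in> {1..L} \<Longrightarrow> m \<in> {1..M} \<Longrightarrow> s_hat m l $ i * q_hat m l $ i
      = (if m = mu then 1 else 0) * s m l * (qvec l i / (x i - pole l)) + e l m $ i"
    by metis
  define v where "v = (\<Sum>l=1..L. \<Sum>m=1..M. e l m)"
  have "v \<in> interference"
    unfolding v_def using e by (intro vec.subspace_sum subspace_eval_code) auto
  moreover have "response scheme M s_hat q_hat $ i
      = (\<Sum>l=1..L. s mu l * (qvec l i / (x i - pole l))) + v $ i" for i
  proof -
    have "response scheme M s_hat q_hat $ i
        = (\<Sum>l=1..L. \<Sum>m=1..M. s_hat m l $ i * q_hat m l $ i)"
      by (simp add: response_def csa_scheme_def)
    also have "\<dots> = (\<Sum>l=1..L. \<Sum>m=1..M.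
        (if m = mu then s mu l * (qvec l i / (x i - pole l)) else 0) + e l m $ i)"
      using prod by (intro sum.cong) auto
    also have "\<dots> = (\<Sum>l=1..L. s mu l * (qvec l i / (x i - pole l))) + v $ i"
      using mu by (simp add: v_def sum.distrib)
    finally show ?thesis .
  qed
  ultimately show ?thesis by blast
qed

lemma scheme_decodable: "pir_decodable scheme"
proof -
  \<comment> \<open>The relation involves neither \<open>M\<close> nor \<open>mu\<close>, so
    choosing any consistent \<open>w\<close> gives one decoder for all cases.\<close>
  define enc where "enc = (\<lambda>r w. \<exists>v\<in>interference. \<forall>i. r $ i
    = (\<Sum>l=1..L. w l * (qvec l i / (x i - pole l))) + v $ i)"
  have unique: "w l = w' l" if w: "enc r w" "enc r w'" and l: "l \<in> {1..L}" for r w w' l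
  proof -
    from w obtain v v' where v: "v \<in> interference" "v' \<in> interference"
      and r: "\<And>i. r $ i = (\<Sum>l=1..L. w l * (qvec l i / (x i - pole l))) + v $ i"
        "\<And>i. r $ i = (\<Sum>l=1..L. w' l * (qvec l i / (x i - pole l))) + v' $ i"
      unfolding enc_def by blast
    have "w l - w' l = 0"
    proof (rule targets_independent[OF _ _ l])
      show "v' - v \<in> interference" using v by (rule vec.subspace_diff[OF subspace_eval_code, rotated])
      show "(\<Sum>l=1..L. (w l - w' l) * (qvec l i / (x i - pole l))) = (v' - v) $ i" for i
        using r[of i]
        by (simp only: left_diff_distrib sum_subtractf vector_minus_component)
           (simp add: algebra_simps)
    qed
    then show ?thesis by simp
  qed
  show ?thesis
    unfolding pir_decodable_def
  proof (intro exI allI ballI impI)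
    fix M mu s s_hat q_hat l
    assume mu: "mu \<in> {1..M}" and out: "storage_outcome scheme M s s_hat" "query_outcome scheme M mu q_hat"
      and "l \<in> {1..num_fragments scheme}"
    then have l: "l \<in> {1..L}" by (simp add: csa_scheme_def)
    let ?r = "response scheme M s_hat q_hat"
    have enc: "enc ?r (s mu)" unfolding enc_def using response_eq[OF mu out] .
    show "(SOME w. enc ?r w) l = s mu l"
      by (rule unique[OF someI[of "enc ?r", OF enc] enc l])
  qed
qed

lemma scheme_is_pir_scheme: "is_pir_scheme scheme"
  unfolding is_pir_scheme_def
  using storage_is_lsss query_is_lsss scheme_decodable storage_vec_nonzero query_vec_nonzero
  by (auto simp: storage_lsss_def query_lsss_def csa_scheme_def dim_span_singleton simp del: vec.dim_span)

end

section \<open>The scheme at the given rational points\<close>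

theorem mainTheorem2:
  fixes H F h :: "'a::{field,finite} poly"
    and g L J Xsec T N :: nat
    and \<gamma> :: "nat \<Rightarrow> 'a"
    and P :: "nat \<Rightarrow> 'a curve_point"
  assumes "g \<ge> 1"
    and "hyperelliptic_curve g H F"
    and "L \<ge> g" and "L mod 2 = g mod 2"
    and "J = (L + g) div 2"
    and "inj_on \<gamma> {1..J}"
    and "\<forall>j\<in>{1..J}. poly F (\<gamma> j) \<noteq> 0"
    and "h = (\<Prod>j = 1..J. [:- \<gamma> j, 1:])"
    and "N = L + Xsec + T + 6 * g + 2"
    and "inj_on P {1..N + g}"
    and "\<forall>n\<in>{1..N + g}. P n \<in> rational_points H F \<and> P n \<noteq> Infinity \<and>
           y_coord (P n) \<noteq> 0 \<and> poly h (x_coord (P n)) \<noteq> 0"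
    and "CARD('n::finite) = N"
  shows "\<exists>S :: ('a, 'n) pir.
           is_pir_scheme S \<and> num_fragments S = L \<and>
           pir_rate S = 1 - real (Xsec + T + 6 * g + 2) / real N \<and>
           pir_secure Xsec S \<and> pir_private T S"
proof -
  obtain idx :: "'n \<Rightarrow> nat" where idx: "bij_betw idx UNIV {1..N}"
    using finite_same_card_bij[of "UNIV :: 'n set" "{1..N}"] assms(12) by auto
  define x y where "x = (\<lambda>i. x_coord (P (idx i)))" and "y = (\<lambda>i. y_coord (P (idx i)))"
  have idx_in: "idx i \<in> {1..N + g}" for i
  proof -
    have "idx i \<in> {1..N}" using bij_betwE[OF idx] by blast
    then show ?thesis by simp
  qed
  have P: "P (idx i) = Affine (x i) (y i)" "y i ^ 2 + poly H (x i) * y i = poly F (x i)" for i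
    using bspec[OF assms(11) idx_in[of i]] by (auto simp: x_def y_def rational_points_def)
  have hroot: "poly h (\<gamma> j) = 0" if "j \<in> {1..J}" for j
    using that unfolding assms(8) poly_prod by (intro prod_zero) auto
  \<comment> \<open>The parity condition makes the division by 2 exact.\<close>
  have J2: "2 * J = L + g" using assms(4,5) by presburger
  interpret csa_points H F g x y \<gamma> J L Xsec T
  proof
    show "degree F = 2 * g + 1" "degree H \<le> g"
      using assms(2) by (simp_all add: hyperelliptic_curve_def)
    show "y i ^ 2 + poly H (x i) * y i = poly F (x i)" for i by (rule P)
    show "i = j" if "x i = x j" "y i = y j" for i j
    proof -
      have "P (idx i) = P (idx j)" using that by (simp add: P(1))
      then have "idx i = idx j" using assms(10) idx_in by (auto dest: inj_onD)
      then show ?thesis using idx by (auto simp: bij_betw_def dest: injD)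
    qed
    show "x i \<noteq> \<gamma> j" if "j \<in> {1..J}" for i j
      using hroot[OF that] bspec[OF assms(11) idx_in[of i]] by (auto simp: x_def)
    show "y i \<noteq> 0" for i using bspec[OF assms(11) idx_in[of i]] by (simp add: y_def)
    show "L \<le> 2 * J" "2 * J + Xsec + T + 4 * g + 1 \<le> CARD('n)"
      using J2 assms(9,12) by simp_all
  qed (rule assms(1), rule assms(6))
  have "pir_rate scheme = 1 - real (Xsec + T + 6 * g + 2) / real N"
    using assms(9,12) by (simp add: pir_rate_def csa_scheme_def field_simps)
  moreover have "num_fragments scheme = L" by (simp add: csa_scheme_def)
  ultimately show ?thesis
    using scheme_is_pir_scheme scheme_secure scheme_private by blast
qed

end
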